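(* For any graph $D$ (loops allowed), consider the following properties. (a) There exists a constant $0<a<1$ such that for any $q$ large enough, $p_2[D,q]\ge a$. (b) There exists a constant $0<b<1$ such that for any $q$ large enough, $p_0[D,q]\ge b$. (c) There exists a constant $0<c<1$ such that for any $q$ large enough, $p_1[D,q]\le c$. (d) There exists a constant $d>0$ such that for any $q$ large enough, $$\frac{1}{|\mathrm{F}[D,q]|}\sum_{f\in\mathrm{F}[D,q]}\mathrm{i}(f)\ge d.$$ Then (a) implies (b), and (b), (c), (d) are equivalent.
   Context: Graphs are finite and directed: $D=(V,E)$ with $V=\{1,\dots,n\}$, $n\ge1$, $E\subseteq V^2$. For an integer $q\ge2$ let $[q]=\{0,\dots,q-1\}$. For $f=(f_1,\dots,f_n):[q]^n\to[q]^n$, the interaction graph $G(f)$ has vertex set $V$ and an arc $(u,v)$ if and only if there exist $x,y\in[q]^n$ differing only in coordinate $u$ with $f_v(x)\ne f_v(y)$. $\mathrm{F}[D,q]$ is the set of all $f:[q]^n\to[q]^n$ with $G(f)=D$. Let $\mathrm{Fix}(f)$ be the set of fixed points of $f$. Then $p_0[D,q]$, $p_1[D,q]$, $p_2[D,q]$ are the proportions of $f\in\mathrm{F}[D,q]$ with $|\mathrm{Fix}(f)|=0$, $|\mathrm{Fix}(f)|=1$, $|\mathrm{Fix}(f)|\ge2$ respectively. With $d_{\mathrm H}$ the Hamming distance, $\mathrm{i}(f)=\min_{x\in[q]^n}d_{\mathrm H}(x,f(x))$. *)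

theory Defs
  imports Complex_Main "HOL-Library.FuncSet" "Graph_Theory.Pair_Digraph"
begin

text \<open>
  A configuration in $[q]^V$ is an extensional function (it is \<open>undefined\<close> outside \<open>V\<close>),
  and so is a map $[q]^V \to [q]^V$.  Hence each set below is in bijection with the set of
  mathematical objects it represents, and cardinalities are the intended ones.
\<close>

definition configs :: "'v set \<Rightarrow> nat \<Rightarrow> ('v \<Rightarrow> nat) set" where
  "configs V q = V \<rightarrow>\<^sub>E {..<q}"

definition diff_coords :: "'v set \<Rightarrow> ('v \<Rightarrow> nat) \<Rightarrow> ('v \<Rightarrow> nat) \<Rightarrow> 'v set" where
  "diff_coords V x y = {v \<in> V. x v \<noteq> y v}"

definition hamming_dist :: "'v set \<Rightarrow> ('v \<Rightarrow> nat) \<Rightarrow> ('v \<Rightarrow> nat) \<Rightarrow> nat" where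
  "hamming_dist V x y = card (diff_coords V x y)"

definition interaction_graph ::
    "'v set \<Rightarrow> nat \<Rightarrow> (('v \<Rightarrow> nat) \<Rightarrow> 'v \<Rightarrow> nat) \<Rightarrow> 'v pair_pre_digraph" where
  "interaction_graph V q f =
     \<lparr> pverts = V,
       parcs = {(u, v). u \<in> V \<and> v \<in> V \<and>
         (\<exists>x \<in> configs V q. \<exists>y \<in> configs V q. diff_coords V x y = {u} \<and> f x v \<noteq> f y v)} \<rparr>"

definition F :: "'v pair_pre_digraph \<Rightarrow> nat \<Rightarrow> (('v \<Rightarrow> nat) \<Rightarrow> 'v \<Rightarrow> nat) set" where
  "F D q = {f \<in> configs (pverts D) q \<rightarrow>\<^sub>E configs (pverts D) q.
              interaction_graph (pverts D) q f = D}"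

definition Fixp :: "'v set \<Rightarrow> nat \<Rightarrow> (('v \<Rightarrow> nat) \<Rightarrow> 'v \<Rightarrow> nat) \<Rightarrow> ('v \<Rightarrow> nat) set" where
  "Fixp V q f = {x \<in> configs V q. f x = x}"

definition p0 :: "'v pair_pre_digraph \<Rightarrow> nat \<Rightarrow> real" where
  "p0 D q = real (card {f \<in> F D q. card (Fixp (pverts D) q f) = 0}) / real (card (F D q))"

definition p1 :: "'v pair_pre_digraph \<Rightarrow> nat \<Rightarrow> real" where
  "p1 D q = real (card {f \<in> F D q. card (Fixp (pverts D) q f) = 1}) / real (card (F D q))"

definition p2 :: "'v pair_pre_digraph \<Rightarrow> nat \<Rightarrow> real" where
  "p2 D q = real (card {f \<in> F D q. card (Fixp (pverts D) q f) \<ge> 2}) / real (card (F D q))"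

definition min_displacement :: "'v set \<Rightarrow> nat \<Rightarrow> (('v \<Rightarrow> nat) \<Rightarrow> 'v \<Rightarrow> nat) \<Rightarrow> nat" where
  "min_displacement V q f = Min ((\<lambda>x. hamming_dist V x (f x)) ` configs V q)"

definition mean_min_displacement :: "'v pair_pre_digraph \<Rightarrow> nat \<Rightarrow> real" where
  "mean_min_displacement D q =
     1 / real (card (F D q)) * (\<Sum>f \<in> F D q. real (min_displacement (pverts D) q f))"

end

theory Submission
  imports Defs "HOL-Combinatorics.Transposition"
begin

text \<open>
  Permuting the values of each local function leaves the interaction graph unchanged, so for a
  uniformly random \<open>f\<close> in \<open>F D q\<close> and a fixed \<open>x\<close> the image \<open>f x\<close> is uniformly distributed.
  Hence the expected number of fixed points is exactly 1, which gives \<open>p1 + 2 p2 \<le> 1\<close>, that is,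
  \<open>p2 \<le> p0\<close>, and therefore \<open>1 - p1 \<le> 2 p0\<close>.  Moreover \<open>i(f)\<close> lies between 1 and \<open>n\<close> if
  \<open>f\<close> has no fixed point and is 0 otherwise, so its mean lies between \<open>p0\<close> and \<open>n p0\<close>.
\<close>

section \<open>Uniform images and the mean number of fixed points\<close>

lemma finite_configs: "finite V \<Longrightarrow> finite (configs V q)"
  by (simp add: configs_def finite_PiE)

lemma configs_nonempty: "q > 0 \<Longrightarrow> configs V q \<noteq> {}"
  by (auto simp: configs_def PiE_eq_empty_iff)

lemma finite_F: "finite (pverts D) \<Longrightarrow> finite (F D q)"
  unfolding F_def
  by (rule finite_subset[of _ "configs (pverts D) q \<rightarrow>\<^sub>E configs (pverts D) q"])
    (auto intro: finite_PiE finite_configs)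

text \<open>Each coordinate gets its own transposition of values, instead of one permutation of
  whole configurations: composing a local function with a bijection of its values preserves its
  dependence on each variable. The two restrictions keep the result extensional.\<close>

definition swap_images ::
    "'v set \<Rightarrow> nat \<Rightarrow> ('v \<Rightarrow> nat) \<Rightarrow> ('v \<Rightarrow> nat) \<Rightarrow>
     (('v \<Rightarrow> nat) \<Rightarrow> 'v \<Rightarrow> nat) \<Rightarrow> ('v \<Rightarrow> nat) \<Rightarrow> 'v \<Rightarrow> nat" where
  "swap_images V q y z f = (\<lambda>x\<in>configs V q. \<lambda>v\<in>V. transpose (y v) (z v) (f x v))"

lemma swap_images_maps:
  assumes "y \<in> configs V q" "z \<in> configs V q" "f \<in> configs V q \<rightarrow>\<^sub>E configs V q"
  shows "swap_images V q y z f \<in> configs V q \<rightarrow>\<^sub>E configs V q"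
proof -
  have "transpose (y v) (z v) (f x v) < q" if "x \<in> configs V q" "v \<in> V" for x v
  proof -
    have "y v < q" "z v < q"
      using assms that by (auto simp: configs_def)
    moreover have "f x v < q"
      using PiE_mem[OF assms(3) that(1)] that(2) by (auto simp: configs_def)
    ultimately show ?thesis
      by (simp add: transpose_def)
  qed
  then show ?thesis
    by (auto simp: swap_images_def configs_def)
qed

lemma swap_images_involution:
  assumes "f \<in> configs V q \<rightarrow>\<^sub>E configs V q"
  shows "swap_images V q y z (swap_images V q y z f) = f"
proof (rule PiE_ext)
  show "swap_images V q y z (swap_images V q y z f) \<in> configs V q \<rightarrow>\<^sub>E UNIV"
    by (simp add: swap_images_def)
  show "f \<in> configs V q \<rightarrow>\<^sub>E UNIV"
    using assms by auto
  show "swap_images V q y z (swap_images V q y z f) x = f x" if "x \<in> configs V q" for x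
    using that PiE_mem[OF assms that]
    by (auto simp: swap_images_def configs_def fun_eq_iff restrict_def PiE_def extensional_def)
qed

text \<open>Transpositions are injective, so two values of a local function differ exactly when
  their images do.\<close>

lemma interaction_graph_swap_images:
  "interaction_graph V q (swap_images V q y z f) = interaction_graph V q f"
proof -
  have "swap_images V q y z f a v \<noteq> swap_images V q y z f b v \<longleftrightarrow> f a v \<noteq> f b v"
    if "a \<in> configs V q" "b \<in> configs V q" "v \<in> V" for a b v
    using that by (simp add: swap_images_def inj_eq[OF inj_transpose])
  then show ?thesis
    unfolding interaction_graph_def by (auto cong: conj_cong)
qed

text \<open>\<open>swap_images\<close> is its own inverse on these maps, hence injective, and it
  turns the value \<open>y\<close> at \<open>x\<close> into \<open>z\<close>. As \<open>y\<close>
  and \<open>z\<close> are arbitrary, all fibres of evaluation at \<open>x\<close> have the same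
  size.\<close>

lemma card_prescribed_image_le:
  assumes "finite (pverts D)" "x \<in> configs (pverts D) q"
    "y \<in> configs (pverts D) q" "z \<in> configs (pverts D) q"
  shows "card {f \<in> F D q. f x = y} \<le> card {f \<in> F D q. f x = z}"
proof (rule card_inj_on_le)
  let ?s = "swap_images (pverts D) q y z"
  show "inj_on ?s {f \<in> F D q. f x = y}"
    by (rule inj_on_inverseI[of _ ?s]) (auto simp: F_def swap_images_involution)
  have "?s f x = z" if "f x = y" for f
    using that assms
    by (auto simp: swap_images_def configs_def fun_eq_iff restrict_def PiE_def extensional_def)
  then show "?s ` {f \<in> F D q. f x = y} \<subseteq> {f \<in> F D q. f x = z}"
    using swap_images_maps[OF assms(3,4)]
    by (auto simp: F_def interaction_graph_swap_images)
  show "finite {f \<in> F D q. f x = z}"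
    using finite_F[OF assms(1)] by simp
qed

text \<open>The fibres of evaluation at \<open>x\<close> partition \<open>F D q\<close> into equally
  large classes, one for each configuration.\<close>

lemma card_prescribed_image:
  assumes "finite (pverts D)" "x \<in> configs (pverts D) q" "y \<in> configs (pverts D) q"
  shows "card (configs (pverts D) q) * card {f \<in> F D q. f x = y} = card (F D q)"
proof -
  let ?C = "configs (pverts D) q"
  have "F D q = (\<Union>z\<in>?C. {f \<in> F D q. f x = z})"
    using assms(2) by (auto simp: F_def)
  then have "card (F D q) = card (\<Union>z\<in>?C. {f \<in> F D q. f x = z})"
    by simp
  also have "\<dots> = (\<Sum>z\<in>?C. card {f \<in> F D q. f x = z})"
    by (rule card_UN_disjoint) (auto simp: finite_configs finite_F assms(1))
  also have "\<dots> = (\<Sum>z\<in>?C. card {f \<in> F D q. f x = y})"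
    by (intro sum.cong refl antisym card_prescribed_image_le assms)
  finally show ?thesis
    by simp
qed

text \<open>Linearity of expectation: the pairs \<open>(f, x)\<close> with \<open>f x = x\<close>
  are counted by \<open>x\<close> instead of \<open>f\<close>, and each \<open>x\<close> is fixed by
  a fraction \<open>1 / card ?C\<close> of the maps. The factor \<open>card ?C\<close> is cancelled
  only at the end, where \<open>q > 0\<close> makes it nonzero.\<close>

lemma sum_card_Fixp:
  assumes "finite (pverts D)" "q > 0"
  shows "(\<Sum>f\<in>F D q. card (Fixp (pverts D) q f)) = card (F D q)"
proof -
  let ?C = "configs (pverts D) q"
  have fin: "finite ?C" "finite (F D q)"
    by (simp_all add: finite_configs finite_F assms)
  have "(\<Sum>f\<in>F D q. card (Fixp (pverts D) q f)) = (\<Sum>f\<in>F D q. \<Sum>x\<in>?C. if f x = x then 1 else 0)"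
    using fin by (simp add: Fixp_def sum.If_cases Int_def)
  also have "\<dots> = (\<Sum>x\<in>?C. card {f \<in> F D q. f x = x})"
    using fin by (subst sum.swap) (simp add: sum.If_cases Int_def)
  finally have "card ?C * (\<Sum>f\<in>F D q. card (Fixp (pverts D) q f)) =
      (\<Sum>x\<in>?C. card ?C * card {f \<in> F D q. f x = x})"
    by (simp add: sum_distrib_left)
  also have "\<dots> = card ?C * card (F D q)"
    by (simp add: card_prescribed_image assms)
  finally show ?thesis
    using configs_nonempty[OF assms(2), of "pverts D"] fin by simp
qed

section \<open>Every digraph is an interaction graph\<close>

lemma F_nonempty:
  assumes "pair_fin_digraph D" "q \<ge> 2"
  shows "F D q \<noteq> {}"
proof -
  interpret pair_fin_digraph D by fact
  let ?V = "pverts D"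
  \<comment> \<open>Each local function is the disjunction of its in-neighbours, with nonzero read
    as true; it is constantly 0 if there are none. The values 0 and 1 exist because
    \<open>q \<ge> 2\<close>.\<close>
  define g where
    "g = (\<lambda>x\<in>configs ?V q. \<lambda>v\<in>?V. if \<exists>u. (u, v) \<in> parcs D \<and> x u \<noteq> 0 then 1 else (0::nat))"
  have maps: "g \<in> configs ?V q \<rightarrow>\<^sub>E configs ?V q"
    using assms(2) by (auto simp: g_def configs_def)
  have sub: "(u, v) \<in> parcs D"
    if *: "v \<in> ?V" "x \<in> configs ?V q" "y \<in> configs ?V q" "diff_coords ?V x y = {u}" "g x v \<noteq> g y v"
    for u v x y
  proof (rule ccontr)
    assume "(u, v) \<notin> parcs D"
    \<comment> \<open>The only coordinate where \<open>x\<close> and \<open>y\<close> differ is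
      \<open>u\<close>, which is not an in-neighbour of \<open>v\<close>.\<close>
    then have "x w = y w" if "(w, v) \<in> parcs D" for w
      using that *(4) in_arcsD1 wellformed by (fastforce simp: diff_coords_def)
    then show False
      using * by (auto simp: g_def split: if_splits)
  qed
  have sup: "\<exists>x\<in>configs ?V q. \<exists>y\<in>configs ?V q. diff_coords ?V x y = {u} \<and> g x v \<noteq> g y v"
    if "(u, v) \<in> parcs D" for u v
  proof -
    have uv: "u \<in> ?V" "v \<in> ?V"
      using wellformed[OF that] by auto
    \<comment> \<open>The zero configuration makes the disjunction at \<open>v\<close> false; a
      single 1 at the in-neighbour \<open>u\<close> makes it true.\<close>
    let ?x = "\<lambda>w\<in>?V. if w = u then 1 else (0::nat)" and ?y = "\<lambda>w\<in>?V. (0::nat)"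
    have C: "?x \<in> configs ?V q" "?y \<in> configs ?V q"
      using assms(2) by (auto simp: configs_def)
    have "diff_coords ?V ?x ?y = {u}"
      using uv by (auto simp: diff_coords_def)
    moreover have "\<exists>w. (w, v) \<in> parcs D \<and> ?x w \<noteq> 0"
      using that uv by auto
    moreover have "\<not> (\<exists>w. (w, v) \<in> parcs D \<and> ?y w \<noteq> 0)"
      using wellformed by fastforce
    ultimately show ?thesis
      using C uv by (intro bexI[of _ ?x] bexI[of _ ?y]) (simp_all add: g_def)
  qed
  have "{(u, v). u \<in> ?V \<and> v \<in> ?V \<and>
      (\<exists>x\<in>configs ?V q. \<exists>y\<in>configs ?V q. diff_coords ?V x y = {u} \<and> g x v \<noteq> g y v)} = parcs D"
    using sub sup wellformed by fastforce
  then have "interaction_graph ?V q g = D"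
    by (simp add: interaction_graph_def)
  with maps have "g \<in> F D q"
    by (simp add: F_def)
  then show ?thesis
    by blast
qed

section \<open>Minimal displacement and fixed points\<close>

lemma hamming_dist_eq_0_iff:
  assumes "finite V" "x \<in> configs V q" "y \<in> configs V q"
  shows "hamming_dist V x y = 0 \<longleftrightarrow> x = y"
proof -
  have "hamming_dist V x y = 0 \<longleftrightarrow> (\<forall>v\<in>V. x v = y v)"
    using assms(1) by (auto simp: hamming_dist_def diff_coords_def)
  also have "\<dots> \<longleftrightarrow> x = y"
    using assms(2,3) by (auto simp: configs_def intro: PiE_ext)
  finally show ?thesis .
qed

lemma min_displacement_eq_0_iff:
  assumes "finite V" "q > 0" "f \<in> configs V q \<rightarrow>\<^sub>E configs V q"
  shows "min_displacement V q f = 0 \<longleftrightarrow> Fixp V q f \<noteq> {}"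
proof -
  let ?S = "(\<lambda>x. hamming_dist V x (f x)) ` configs V q"
  have S: "finite ?S" "?S \<noteq> {}"
    using finite_configs[OF assms(1)] configs_nonempty[OF assms(2)] by auto
  \<comment> \<open>A minimum of naturals over a finite nonempty set is 0 only if 0 is
    attained.\<close>
  have "Min ?S = 0 \<longleftrightarrow> 0 \<in> ?S"
    using S by (auto simp: Min_eq_iff)
  also have "\<dots> \<longleftrightarrow> (\<exists>x\<in>configs V q. hamming_dist V x (f x) = 0)"
    by (force simp: image_iff)
  also have "\<dots> \<longleftrightarrow> (\<exists>x\<in>configs V q. f x = x)"
    using hamming_dist_eq_0_iff[OF assms(1)] PiE_mem[OF assms(3)] by metis
  finally show ?thesis
    by (auto simp: min_displacement_def Fixp_def)
qed

lemma min_displacement_le_card: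
  assumes "finite V" "q > 0"
  shows "min_displacement V q f \<le> card V"
proof -
  obtain x where x: "x \<in> configs V q"
    using configs_nonempty[OF assms(2)] by blast
  have "min_displacement V q f \<le> hamming_dist V x (f x)"
    unfolding min_displacement_def using x finite_configs[OF assms(1)] by (intro Min_le) auto
  also have "\<dots> \<le> card V"
    unfolding hamming_dist_def diff_coords_def using assms(1) by (intro card_mono) auto
  finally show ?thesis .
qed

section \<open>Inequalities between the proportions\<close>

context
  fixes D :: "'v pair_pre_digraph" and q :: nat
  assumes D: "pair_fin_digraph D" and q: "q \<ge> 2"
begin

lemma finite_verts: "finite (pverts D)"
  using D by (simp add: pair_fin_digraph_def pair_fin_digraph_axioms_def)

text \<open>Makes the denominators nonzero; with division by 0 equal to 0, the proportions would
  otherwise sum to 0.\<close>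

lemma card_F_pos: "card (F D q) > 0"
  using F_nonempty[OF D q] finite_F[OF finite_verts] by (simp add: card_gt_0_iff)

lemma p0_p1_p2_sum: "p0 D q + p1 D q + p2 D q = 1"
proof -
  let ?N = "\<lambda>f. card (Fixp (pverts D) q f)"
  have "card (F D q) = (\<Sum>f\<in>F D q. 1)"
    by simp
  also have "\<dots> = (\<Sum>f\<in>F D q. (if ?N f = 0 then 1 else 0) + (if ?N f = 1 then 1 else 0)
      + (if ?N f \<ge> 2 then 1 else 0))"
    by (rule sum.cong) auto
  also have "\<dots> = card {f \<in> F D q. ?N f = 0} + card {f \<in> F D q. ?N f = 1}
      + card {f \<in> F D q. ?N f \<ge> 2}"
    using finite_F[OF finite_verts, of q] by (simp only: sum.distrib) (simp add: sum.If_cases Int_def)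
  finally show ?thesis
    using card_F_pos unfolding p0_def p1_def p2_def
    by (simp add: add_divide_distrib[symmetric] del: of_nat_add flip: of_nat_add)
qed

text \<open>A Markov-type bound: \<open>?N f\<close> dominates the indicator of
  \<open>?N f = 1\<close> plus twice that of \<open>?N f \<ge> 2\<close>, and its mean is 1.\<close>

lemma p1_p2_le: "p1 D q + 2 * p2 D q \<le> 1"
proof -
  let ?N = "\<lambda>f. card (Fixp (pverts D) q f)"
  note fin = finite_F[OF finite_verts, of q]
  have "card {f \<in> F D q. ?N f = 1} + 2 * card {f \<in> F D q. ?N f \<ge> 2} =
      (\<Sum>f\<in>F D q. (if ?N f = 1 then 1 else 0) + 2 * (if ?N f \<ge> 2 then 1 else 0))"
    using fin by (simp add: sum.distrib sum.If_cases Int_def flip: sum_distrib_left)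
  also have "\<dots> \<le> (\<Sum>f\<in>F D q. ?N f)"
    by (rule sum_mono) auto
  also have "\<dots> = card (F D q)"
    using sum_card_Fixp[OF finite_verts] q by simp
  finally have "real (card {f \<in> F D q. ?N f = 1}) + 2 * real (card {f \<in> F D q. ?N f \<ge> 2})
      \<le> real (card (F D q))"
    by linarith
  then show ?thesis
    using card_F_pos unfolding p1_def p2_def by (simp add: field_simps)
qed

lemma p2_nonneg: "p2 D q \<ge> 0"
  by (simp add: p2_def)

lemma p0_le_mean_min_displacement: "p0 D q \<le> mean_min_displacement D q"
  and mean_min_displacement_le: "mean_min_displacement D q \<le> real (card (pverts D)) * p0 D q"
proof -
  let ?V = "pverts D"
  let ?I = "\<lambda>f. if card (Fixp ?V q f) = 0 then 1 else (0::real)"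
  let ?S = "\<Sum>f\<in>F D q. real (min_displacement ?V q f)"
  have card: "real (card {f \<in> F D q. card (Fixp ?V q f) = 0}) = (\<Sum>f\<in>F D q. ?I f)"
    using finite_F[OF finite_verts] by (simp add: sum.If_cases Int_def)
  have bounds: "?I f \<le> real (min_displacement ?V q f)
      \<and> real (min_displacement ?V q f) \<le> real (card ?V) * ?I f" if "f \<in> F D q" for f
  proof -
    \<comment> \<open>Finiteness of the configurations matters here: an infinite \<open>Fixp\<close>
      would also have \<open>card\<close> 0.\<close>
    have "min_displacement ?V q f = 0 \<longleftrightarrow> card (Fixp ?V q f) \<noteq> 0"
      using min_displacement_eq_0_iff[OF finite_verts, of q f] that q finite_configs[OF finite_verts]
      by (simp add: F_def Fixp_def)
    then show ?thesis
      using min_displacement_le_card[OF finite_verts, of q f] q by auto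
  qed
  have "(\<Sum>f\<in>F D q. ?I f) \<le> ?S"
    using bounds by (intro sum_mono) blast
  then show "p0 D q \<le> mean_min_displacement D q"
    using card_F_pos by (simp add: p0_def card mean_min_displacement_def divide_right_mono)
  have "?S \<le> (\<Sum>f\<in>F D q. real (card ?V) * ?I f)"
    using bounds by (intro sum_mono) blast
  also have "\<dots> = real (card ?V) * (\<Sum>f\<in>F D q. ?I f)"
    by (rule sum_distrib_left[symmetric])
  finally show "mean_min_displacement D q \<le> real (card ?V) * p0 D q"
    using card_F_pos by (simp add: p0_def card mean_min_displacement_def divide_right_mono)
qed

end

section \<open>Comparison of the asymptotic properties\<close>

theorem proposition4p4:
  fixes n :: nat and D :: "nat pair_pre_digraph"
  assumes "n \<ge> 1" and "pair_fin_digraph D" and "pverts D = {1..n}"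
  shows
    "((\<exists>a::real. 0 < a \<and> a < 1 \<and> (\<forall>\<^sub>F q in sequentially. p2 D q \<ge> a)) \<longrightarrow>
      (\<exists>b::real. 0 < b \<and> b < 1 \<and> (\<forall>\<^sub>F q in sequentially. p0 D q \<ge> b)))
   \<and> ((\<exists>b::real. 0 < b \<and> b < 1 \<and> (\<forall>\<^sub>F q in sequentially. p0 D q \<ge> b)) \<longleftrightarrow>
      (\<exists>c::real. 0 < c \<and> c < 1 \<and> (\<forall>\<^sub>F q in sequentially. p1 D q \<le> c)))
   \<and> ((\<exists>c::real. 0 < c \<and> c < 1 \<and> (\<forall>\<^sub>F q in sequentially. p1 D q \<le> c)) \<longleftrightarrow>
      (\<exists>d::real. 0 < d \<and> (\<forall>\<^sub>F q in sequentially. mean_min_displacement D q \<ge> d)))"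
    (is "(?A \<longrightarrow> ?B) \<and> (?B \<longleftrightarrow> ?C) \<and> (?C \<longleftrightarrow> ?D)")
proof -
  note D = assms(2)
  note large = eventually_ge_at_top[of "2::nat"]
  have ab: ?B if ?A
  proof -
    from that obtain a :: real where a: "0 < a" "a < 1" "\<forall>\<^sub>F q in sequentially. p2 D q \<ge> a"
      by blast
    \<comment> \<open>Subtracting \<open>p0 + p1 + p2 = 1\<close> from
      \<open>p1 + 2 * p2 \<le> 1\<close> gives \<open>p2 \<le> p0\<close>, so the same constant
      serves.\<close>
    from a(3) large have "\<forall>\<^sub>F q in sequentially. p0 D q \<ge> a"
    proof eventually_elim
      case (elim q)
      then show ?case
        using p0_p1_p2_sum[OF D, of q] p1_p2_le[OF D, of q] by linarith
    qed
    with a show ?thesis by blast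
  qed
  have bc: ?C if ?B
  proof -
    from that obtain b :: real where b: "0 < b" "b < 1" "\<forall>\<^sub>F q in sequentially. p0 D q \<ge> b"
      by blast
    from b(3) large have "\<forall>\<^sub>F q in sequentially. p1 D q \<le> 1 - b"
    proof eventually_elim
      case (elim q)
      then show ?case
        using p0_p1_p2_sum[OF D, of q] p2_nonneg[OF D, of q] by linarith
    qed
    moreover have "0 < 1 - b" "1 - b < 1"
      using b by auto
    ultimately show ?thesis by blast
  qed
  have cb: ?B if ?C
  proof -
    from that obtain c :: real where c: "0 < c" "c < 1" "\<forall>\<^sub>F q in sequentially. p1 D q \<le> c"
      by blast
    \<comment> \<open>The factor 1/2 comes from
      \<open>1 - p1 = p0 + p2 \<le> 2 * p0\<close>.\<close>
    from c(3) large have "\<forall>\<^sub>F q in sequentially. p0 D q \<ge> (1 - c) / 2"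
    proof eventually_elim
      case (elim q)
      then have "1 - c \<le> 2 * p0 D q"
        using p0_p1_p2_sum[OF D, of q] p1_p2_le[OF D, of q] by linarith
      then show ?case by simp
    qed
    moreover have "0 < (1 - c) / 2" "(1 - c) / 2 < 1"
      using c by auto
    ultimately show ?thesis by blast
  qed
  have bd: ?D if ?B
  proof -
    from that obtain b :: real where b: "0 < b" "b < 1" "\<forall>\<^sub>F q in sequentially. p0 D q \<ge> b"
      by blast
    from b(3) large have "\<forall>\<^sub>F q in sequentially. mean_min_displacement D q \<ge> b"
    proof eventually_elim
      case (elim q)
      then show ?case
        using p0_le_mean_min_displacement[OF D, of q] by linarith
    qed
    with b show ?thesis by blast
  qed
  have db: ?B if ?D
  proof -
    from that obtain d :: real
      where d: "0 < d" "\<forall>\<^sub>F q in sequentially. mean_min_displacement D q \<ge> d"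
      by blast
    \<comment> \<open>Since \<open>d\<close> has no upper bound by hypothesis, the cap 1/2 keeps the
      constant below 1.\<close>
    let ?b = "min (d / real n) (1 / 2)"
    from d(2) large have "\<forall>\<^sub>F q in sequentially. p0 D q \<ge> ?b"
    proof eventually_elim
      case (elim q)
      then have "d \<le> real n * p0 D q"
        using mean_min_displacement_le[OF D, of q] assms(3) by simp
      then have "d / real n \<le> p0 D q"
        using assms(1) by (simp add: field_simps)
      then show ?case by linarith
    qed
    moreover have "0 < ?b" "?b < 1"
      using d assms(1) by auto
    ultimately show ?thesis by blast
  qed
  show ?thesis
    \<comment> \<open>Every implication starts or ends at \<open>?B\<close>, so the equivalence of
      \<open>?C\<close> and \<open>?D\<close> passes through it.\<close>
    using ab bc cb bd db by blast
qed

end
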